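(* Let $F,G\in\mathcal R$, $\mathbf a\in\mathbb F^n$ and $m=x_{i_1}\cdots x_{i_s}\in\mathcal M$ with $i_l\in\{1,\dots,n\}$ for all $l=1,\dots,s$. Then $$\Delta^m_{\mathbf a}(F\cdot G)(\mathbf x)=F(\mathbf x)\cdot\Delta^m_{\mathbf a}G(\mathbf x)+\sum_{k=1}^s\Delta_{\mathbf a}^{x_{i_1}\cdots x_{i_k}}\Big(F\cdot\Delta_{\mathbf a}^{x_{i_{k+1}}\cdots x_{i_s}}G(\mathbf a)\Big)(\mathbf x),$$ and, if $\varphi$ is an isomorphism of additive groups, $$\Delta^m_{\mathbf a,L}(F\cdot G)(\mathbf x)=\Delta^m_{\mathbf a,L}F(\mathbf x)\cdot G(\mathbf x)+\sum_{k=1}^s\Delta_{\mathbf a,L}^{x_{i_1}\cdots x_{i_k}}\Big(\big(\Delta_{\mathbf a,L}^{x_{i_{k+1}}\cdots x_{i_s}}F\big)_L(\mathbf a)\cdot G\Big)(\mathbf x),$$ where for $k=s$ the empty product $x_{i_{k+1}}\cdots x_{i_s}$ means the empty monomial $o$.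
   Context: $\mathbb F$ is a division ring, $n\ge1$, $\sigma=(\sigma_{i,j}):\mathbb F\to\mathbb F^{n\times n}$ is a (unital) ring homomorphism and $\delta={}^t(\delta_1,\dots,\delta_n):\mathbb F\to\mathbb F^{n\times1}$ is a $\sigma$-vector derivation, i.e. additive with $\delta(ab)=\sigma(a)\delta(b)+\delta(a)b$. $\mathcal M$ is the free monoid on $x_1,\dots,x_n$, with empty word $o$ (identified with $1$). $\mathcal R=\mathbb F[\mathbf x;\sigma,\delta]$ is the free left $\mathbb F$-module with basis $\mathcal M$, with the ring multiplication that concatenates monomials and satisfies $x_i a=\sum_j\sigma_{i,j}(a)x_j+\delta_i(a)$ for $a\in\mathbb F$. Define $\varphi:\mathbb F^n\to\mathbb F^n$ by $\varphi(\gamma_1,\dots,\gamma_n)=\big(\sum_j\sigma_{j,1}(\gamma_j),\dots,\sum_j\sigma_{j,n}(\gamma_j)\big)$. For $\mathbf a=(a_1,\dots,a_n)\in\mathbb F^n$ every $F\in\mathcal R$ is uniquely $F=\sum_i(\Delta_{\mathbf a}^{x_i}F)\,(x_i-a_i)+F(\mathbf a)$ with $\Delta_{\mathbf a}^{x_i}F\in\mathcal R$, $F(\mathbf a)\in\mathbb F$. When $\varphi$ is bijective, every $F$ is uniquely $F=\sum_i(x_i-a_i)\,(\Delta_{\mathbf a,L}^{x_i}F)+F_L(\mathbf a)$ with $\Delta_{\mathbf a,L}^{x_i}F\in\mathcal R$, $F_L(\mathbf a)\in\mathbb F$. For $m=x_{i_1}\cdots x_{i_s}$: $\Delta_{\mathbf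 a}^mF=\Delta_{\mathbf a}^{x_{i_1}}(\Delta_{\mathbf a}^{x_{i_2}}(\cdots(\Delta_{\mathbf a}^{x_{i_s}}F)))$ and $\Delta_{\mathbf a,L}^mF=\Delta_{\mathbf a,L}^{x_{i_s}}(\Delta_{\mathbf a,L}^{x_{i_{s-1}}}(\cdots(\Delta_{\mathbf a,L}^{x_{i_1}}F)))$; $\Delta^o_{\mathbf a}F=\Delta^o_{\mathbf a,L}F=F$. $\Delta_{\mathbf a}^mF(\mathbf a)$ and $(\Delta_{\mathbf a,L}^mF)_L(\mathbf a)$ are the right, respectively left, evaluations at $\mathbf a$ of the polynomials $\Delta_{\mathbf a}^mF$ and $\Delta_{\mathbf a,L}^mF$; they are elements of $\mathbb F$.
   Formalization: The left formula is false as displayed (σ(c)=cI, δ=0, a=0, F=x_1, G=x_2, m=x_1x_2 gives 1=0); in the k-th summand the outer word is corrected to the last k letters of m and the inner word to the first s-k letters. *)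

theory Defs
  imports "HOL-Analysis.Cartesian_Space" "HOL-Library.Poly_Mapping"
begin

text \<open>The index type \<open>'n\<close> is finite and nonempty and plays the role of \<open>{1, \<dots>, n}\<close>; the word
  \<open>[i\<^sub>1, \<dots>, i\<^sub>s]\<close> is the monomial \<open>x\<^bsub>i\<^sub>1\<^esub> \<cdots> x\<^bsub>i\<^sub>s\<^esub>\<close>, with \<open>[]\<close> the monomial \<open>1\<close>. The free left
  module on the monomials is the type of finitely supported coefficient functions.\<close>

type_synonym ('a, 'n) skew_poly = "'n list \<Rightarrow>\<^sub>0 'a"

definition matrix_ring_hom :: "('a::division_ring \<Rightarrow> 'a^'n^'n) \<Rightarrow> bool" where
  "matrix_ring_hom \<sigma> \<longleftrightarrow>
     \<sigma> 1 = mat 1 \<and>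
     (\<forall>a b. \<sigma> (a + b) = \<sigma> a + \<sigma> b) \<and>
     (\<forall>a b. \<sigma> (a * b) = \<sigma> a ** \<sigma> b)"

definition vector_derivation ::
    "('a::division_ring \<Rightarrow> 'a^'n^'n) \<Rightarrow> ('a \<Rightarrow> 'a^'n) \<Rightarrow> bool" where
  "vector_derivation \<sigma> \<delta> \<longleftrightarrow>
     (\<forall>a b. \<delta> (a + b) = \<delta> a + \<delta> b) \<and>
     (\<forall>a b. \<delta> (a * b) = \<sigma> a *v \<delta> b + (\<chi> i. \<delta> a $ i * b))"

definition phi :: "('a::division_ring \<Rightarrow> 'a^'n^'n) \<Rightarrow> 'a^'n \<Rightarrow> 'a^'n" where
  "phi \<sigma> \<gamma> = (\<chi> i. \<Sum>j\<in>UNIV. \<sigma> (\<gamma> $ j) $ j $ i)"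

definition const :: "'a::zero \<Rightarrow> ('a, 'n) skew_poly" where
  "const c = Poly_Mapping.single [] c"

definition X :: "'n \<Rightarrow> ('a::zero_neq_one, 'n) skew_poly" where
  "X i = Poly_Mapping.single [i] 1"

definition scale :: "'a::mult_zero \<Rightarrow> ('a, 'n) skew_poly \<Rightarrow> ('a, 'n) skew_poly" where
  "scale c F = Poly_Mapping.map ((*) c) F"

text \<open>Left multiplication by \<open>x\<^sub>i\<close>: each term \<open>c m\<close> of \<open>G\<close> contributes
  \<open>x\<^sub>i c m = \<Sum>\<^sub>j \<sigma>\<^sub>i\<^sub>j(c) x\<^sub>j m + \<delta>\<^sub>i(c) m\<close>.\<close>

definition X_times ::
    "('a::division_ring \<Rightarrow> 'a^'n^'n) \<Rightarrow> ('a \<Rightarrow> 'a^'n) \<Rightarrow> 'n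
      \<Rightarrow> ('a, 'n) skew_poly \<Rightarrow> ('a, 'n) skew_poly" where
  "X_times \<sigma> \<delta> i G = (\<Sum>m\<in>Poly_Mapping.keys G.
     (\<Sum>j\<in>UNIV. Poly_Mapping.single (j # m) (\<sigma> (Poly_Mapping.lookup G m) $ i $ j))
     + Poly_Mapping.single m (\<delta> (Poly_Mapping.lookup G m) $ i))"

definition mult ::
    "('a::division_ring \<Rightarrow> 'a^'n^'n) \<Rightarrow> ('a \<Rightarrow> 'a^'n)
      \<Rightarrow> ('a, 'n) skew_poly \<Rightarrow> ('a, 'n) skew_poly \<Rightarrow> ('a, 'n) skew_poly" where
  "mult \<sigma> \<delta> F G = (\<Sum>m\<in>Poly_Mapping.keys F.
     scale (Poly_Mapping.lookup F m) (foldr (X_times \<sigma> \<delta>) m G))"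

definition right_division ::
    "('a::division_ring \<Rightarrow> 'a^'n^'n) \<Rightarrow> ('a \<Rightarrow> 'a^'n) \<Rightarrow> 'a^'n
      \<Rightarrow> ('a, 'n) skew_poly \<Rightarrow> ('n \<Rightarrow> ('a, 'n) skew_poly) \<times> 'a" where
  "right_division \<sigma> \<delta> a F = (THE (Q, c).
     F = (\<Sum>i\<in>UNIV. mult \<sigma> \<delta> (Q i) (X i - const (a $ i))) + const c)"

definition left_division ::
    "('a::division_ring \<Rightarrow> 'a^'n^'n) \<Rightarrow> ('a \<Rightarrow> 'a^'n) \<Rightarrow> 'a^'n
      \<Rightarrow> ('a, 'n) skew_poly \<Rightarrow> ('n \<Rightarrow> ('a, 'n) skew_poly) \<times> 'a" where
  "left_division \<sigma> \<delta> a F = (THE (Q, c).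
     F = (\<Sum>i\<in>UNIV. mult \<sigma> \<delta> (X i - const (a $ i)) (Q i)) + const c)"

definition eval_right ::
    "('a::division_ring \<Rightarrow> 'a^'n^'n) \<Rightarrow> ('a \<Rightarrow> 'a^'n) \<Rightarrow> 'a^'n \<Rightarrow> ('a, 'n) skew_poly \<Rightarrow> 'a" where
  "eval_right \<sigma> \<delta> a F = snd (right_division \<sigma> \<delta> a F)"

definition eval_left ::
    "('a::division_ring \<Rightarrow> 'a^'n^'n) \<Rightarrow> ('a \<Rightarrow> 'a^'n) \<Rightarrow> 'a^'n \<Rightarrow> ('a, 'n) skew_poly \<Rightarrow> 'a" where
  "eval_left \<sigma> \<delta> a F = snd (left_division \<sigma> \<delta> a F)"

text \<open>For the word \<open>[i\<^sub>1, \<dots>, i\<^sub>s]\<close> the right operator applies \<open>x\<^bsub>i\<^sub>s\<^esub>\<close> first and \<open>x\<^bsub>i\<^sub>1\<^esub>\<close> last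
  (\<open>foldr\<close>), the left operator applies \<open>x\<^bsub>i\<^sub>1\<^esub>\<close> first and \<open>x\<^bsub>i\<^sub>s\<^esub>\<close> last (\<open>fold\<close>).
  Since the orders are opposite, so are the splittings in the two product rules for \<open>m\<close>: the
  operator applied last is indexed by a prefix of \<open>m\<close> on the right but by a suffix on the left. With
  a prefix the left rule fails, already for \<open>F = x\<^sub>1\<close>, \<open>G = x\<^sub>2\<close>, \<open>m = x\<^sub>1 x\<^sub>2\<close>, \<open>a = 0\<close>, \<open>\<delta> = 0\<close> and \<open>\<sigma>\<close> diagonal.\<close>

definition Delta ::
    "('a::division_ring \<Rightarrow> 'a^'n^'n) \<Rightarrow> ('a \<Rightarrow> 'a^'n) \<Rightarrow> 'a^'n \<Rightarrow> 'n list
      \<Rightarrow> ('a, 'n) skew_poly \<Rightarrow> ('a, 'n) skew_poly" where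
  "Delta \<sigma> \<delta> a m F = foldr (\<lambda>i G. fst (right_division \<sigma> \<delta> a G) i) m F"

definition Delta_left ::
    "('a::division_ring \<Rightarrow> 'a^'n^'n) \<Rightarrow> ('a \<Rightarrow> 'a^'n) \<Rightarrow> 'a^'n \<Rightarrow> 'n list
      \<Rightarrow> ('a, 'n) skew_poly \<Rightarrow> ('a, 'n) skew_poly" where
  "Delta_left \<sigma> \<delta> a m F = fold (\<lambda>i G. fst (left_division \<sigma> \<delta> a G) i) m F"

text \<open>The multiplication is the intended one: it makes the free left module a ring with unit
  \<open>const 1\<close>, extends scalar multiplication, concatenates monomials and obeys the commutation rule.\<close>

lemma skew_poly_induct [case_names zero single add]:
  fixes F :: "'k \<Rightarrow>\<^sub>0 'a::comm_monoid_add"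
  assumes "P 0" and "\<And>k c. P (Poly_Mapping.single k c)"
    and "\<And>F G. P F \<Longrightarrow> P G \<Longrightarrow> P (F + G)"
  shows "P F"
proof -
  have "F = (\<Sum>k\<in>Poly_Mapping.keys F. Poly_Mapping.single k (Poly_Mapping.lookup F k))"
    by (rule poly_mapping_eqI)
      (auto simp: lookup_sum lookup_single when_def in_keys_iff)
  moreover have "P (\<Sum>k\<in>A. Poly_Mapping.single k (Poly_Mapping.lookup F k))" if "finite A" for A
    using that by (induction A) (auto intro: assms)
  ultimately show ?thesis
    by (metis finite_keys)
qed

lemma sum_keys_additive:
  fixes F G :: "'k \<Rightarrow>\<^sub>0 'a::comm_monoid_add" and f :: "'k \<Rightarrow> 'a \<Rightarrow> 'b::comm_monoid_add"
  assumes f0: "\<And>k. f k 0 = 0" and fadd: "\<And>k a b. f k (a + b) = f k a + f k b"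
  shows "(\<Sum>k\<in>Poly_Mapping.keys (F + G). f k (Poly_Mapping.lookup (F + G) k)) =
    (\<Sum>k\<in>Poly_Mapping.keys F. f k (Poly_Mapping.lookup F k)) +
    (\<Sum>k\<in>Poly_Mapping.keys G. f k (Poly_Mapping.lookup G k))"
proof -
  let ?K = "Poly_Mapping.keys F \<union> Poly_Mapping.keys G"
  have ext: "(\<Sum>k\<in>Poly_Mapping.keys H. f k (Poly_Mapping.lookup H k)) =
      (\<Sum>k\<in>?K. f k (Poly_Mapping.lookup H k))" if "Poly_Mapping.keys H \<subseteq> ?K" for H
    by (rule sum.mono_neutral_left) (use that in \<open>auto simp: in_keys_iff f0\<close>)
  show ?thesis
    by (subst (1 2 3) ext) (auto simp: keys_add lookup_add fadd sum.distrib dest: subsetD[OF keys_add])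
qed

lemma lookup_scale [simp]: "Poly_Mapping.lookup (scale c F) m = c * Poly_Mapping.lookup F m"
  by (simp add: scale_def Poly_Mapping.map.rep_eq when_def)

lemma scale_add: "scale c (F + G) = scale c F + scale c G"
  for c :: "'a::division_ring"
  by (rule poly_mapping_eqI) (simp add: lookup_add algebra_simps)

lemma scale_add_left: "scale (c + d) F = scale c F + scale d F"
  for c :: "'a::division_ring"
  by (rule poly_mapping_eqI) (simp add: lookup_add algebra_simps)

lemma scale_scale: "scale c (scale d F) = scale (c * d) F"
  for c :: "'a::division_ring"
  by (rule poly_mapping_eqI) (simp add: algebra_simps)

lemma scale_zero [simp]: "scale c 0 = 0" "scale 0 F = 0"
  for c :: "'a::division_ring"
  by (rule poly_mapping_eqI, simp)+

lemma scale_one [simp]: "scale 1 F = F"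
  for F :: "('a::division_ring, 'n) skew_poly"
  by (rule poly_mapping_eqI) simp

lemma scale_single [simp]:
  "scale c (Poly_Mapping.single m d) = Poly_Mapping.single m (c * d)"
  for c :: "'a::division_ring"
  by (rule poly_mapping_eqI) (simp add: lookup_single when_def)

lemma scale_sum: "scale c (sum f A) = (\<Sum>i\<in>A. scale c (f i))"
  for c :: "'a::division_ring"
  by (induction A rule: infinite_finite_induct) (auto simp: scale_add)

context
  fixes \<sigma> :: "'a::division_ring \<Rightarrow> 'a^'n^'n" and \<delta> :: "'a \<Rightarrow> 'a^'n"
  assumes hom: "matrix_ring_hom \<sigma>" and der: "vector_derivation \<sigma> \<delta>"
begin

lemma sigma_add: "\<sigma> (b + c) = \<sigma> b + \<sigma> c"
  and sigma_mult: "\<sigma> (b * c) = \<sigma> b ** \<sigma> c"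
  and sigma_one: "\<sigma> 1 = mat 1"
  using hom by (auto simp: matrix_ring_hom_def)

lemma sigma_zero: "\<sigma> 0 = 0"
  using sigma_add[of 0 0] by simp

lemma delta_add: "\<delta> (b + c) = \<delta> b + \<delta> c"
  and delta_mult: "\<delta> (b * c) = \<sigma> b *v \<delta> c + (\<chi> i. \<delta> b $ i * c)"
  using der by (auto simp: vector_derivation_def)

lemma delta_zero: "\<delta> 0 = 0"
  using delta_add[of 0 0] by simp

lemma delta_one: "\<delta> 1 = 0"
  using delta_mult[of 1 1] by (simp add: sigma_one vec_eq_iff)

lemma X_times_zero [simp]: "X_times \<sigma> \<delta> i 0 = 0"
  by (simp add: X_times_def)

lemma X_times_add: "X_times \<sigma> \<delta> i (F + G) = X_times \<sigma> \<delta> i F + X_times \<sigma> \<delta> i G"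
  unfolding X_times_def
  by (rule sum_keys_additive)
    (simp_all add: sigma_zero delta_zero sigma_add delta_add single_add sum.distrib algebra_simps)

lemma X_times_sum: "X_times \<sigma> \<delta> i (sum f A) = (\<Sum>j\<in>A. X_times \<sigma> \<delta> i (f j))"
  by (induction A rule: infinite_finite_induct) (auto simp: X_times_add)

lemma X_times_single:
  "X_times \<sigma> \<delta> i (Poly_Mapping.single m c) =
    (\<Sum>j\<in>UNIV. Poly_Mapping.single (j # m) (\<sigma> c $ i $ j)) + Poly_Mapping.single m (\<delta> c $ i)"
  by (simp add: X_times_def sigma_zero delta_zero)

lemma sum_single: "(\<Sum>i\<in>A. Poly_Mapping.single k (f i)) = Poly_Mapping.single k (sum f A)"
  for f :: "'b \<Rightarrow> 'a"
  by (induction A rule: infinite_finite_induct) (auto simp: single_add)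

lemma X_times_scale:
  "X_times \<sigma> \<delta> i (scale b F) =
    (\<Sum>j\<in>UNIV. scale (\<sigma> b $ i $ j) (X_times \<sigma> \<delta> j F)) + scale (\<delta> b $ i) F"
proof (induction F rule: skew_poly_induct)
  case (single m c)
  have "(\<Sum>j\<in>UNIV. scale (\<sigma> b $ i $ j) (X_times \<sigma> \<delta> j (Poly_Mapping.single m c))) =
      (\<Sum>k\<in>UNIV. \<Sum>j\<in>UNIV. Poly_Mapping.single (k # m) (\<sigma> b $ i $ j * \<sigma> c $ j $ k)) +
      (\<Sum>j\<in>UNIV. Poly_Mapping.single m (\<sigma> b $ i $ j * \<delta> c $ j))"
    by (subst sum.swap) (simp add: X_times_single scale_add scale_sum sum.distrib)
  then show ?case
    by (simp add: X_times_single sigma_mult delta_mult sum_single matrix_matrix_mult_def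
        matrix_vector_mult_def single_add algebra_simps)
qed (simp_all add: scale_add X_times_add sum.distrib algebra_simps)

lemma word_times_add:
  "foldr (X_times \<sigma> \<delta>) m (F + G) = foldr (X_times \<sigma> \<delta>) m F + foldr (X_times \<sigma> \<delta>) m G"
  by (induction m) (auto simp: X_times_add)

lemma word_times_zero [simp]: "foldr (X_times \<sigma> \<delta>) m 0 = 0"
  by (induction m) auto

lemma mult_zero [simp]: "mult \<sigma> \<delta> 0 F = 0" "mult \<sigma> \<delta> F 0 = 0"
  by (auto simp: mult_def)

lemma mult_add_left: "mult \<sigma> \<delta> (F + G) H = mult \<sigma> \<delta> F H + mult \<sigma> \<delta> G H"
  unfolding mult_def by (rule sum_keys_additive) (simp_all add: scale_add_left)

lemma mult_add_right: "mult \<sigma> \<delta> F (G + H) = mult \<sigma> \<delta> F G + mult \<sigma> \<delta> F H"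
  by (simp add: mult_def word_times_add scale_add sum.distrib)

lemma mult_single: "mult \<sigma> \<delta> (Poly_Mapping.single m c) G = scale c (foldr (X_times \<sigma> \<delta>) m G)"
  by (simp add: mult_def)

lemma mult_scale: "mult \<sigma> \<delta> (scale c F) G = scale c (mult \<sigma> \<delta> F G)"
  by (induction F rule: skew_poly_induct)
    (simp_all add: scale_add mult_add_left mult_single scale_scale)

lemma mult_sum_left: "mult \<sigma> \<delta> (sum f A) G = (\<Sum>i\<in>A. mult \<sigma> \<delta> (f i) G)"
  by (induction A rule: infinite_finite_induct) (auto simp: mult_add_left)

lemma mult_X_times: "mult \<sigma> \<delta> (X_times \<sigma> \<delta> i F) G = X_times \<sigma> \<delta> i (mult \<sigma> \<delta> F G)"
  by (induction F rule: skew_poly_induct)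
    (simp_all add: X_times_add mult_add_left X_times_single mult_single mult_sum_left X_times_scale)

lemma mult_word_times:
  "mult \<sigma> \<delta> (foldr (X_times \<sigma> \<delta>) m F) G = foldr (X_times \<sigma> \<delta>) m (mult \<sigma> \<delta> F G)"
  by (induction m) (auto simp: mult_X_times)

lemma mult_assoc: "mult \<sigma> \<delta> (mult \<sigma> \<delta> F G) H = mult \<sigma> \<delta> F (mult \<sigma> \<delta> G H)"
  by (induction F rule: skew_poly_induct)
    (simp_all add: mult_add_left mult_single mult_scale mult_word_times)

lemma mult_const: "mult \<sigma> \<delta> (const c) F = scale c F"
  by (simp add: const_def mult_single)

lemma mult_one_left: "mult \<sigma> \<delta> (const 1) F = F"
  by (simp add: mult_const)

lemma word_times_single_one:
  "foldr (X_times \<sigma> \<delta>) m (Poly_Mapping.single m' 1) = Poly_Mapping.single (m @ m') 1"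
proof (induction m)
  case (Cons i m)
  have "(\<Sum>j\<in>UNIV. Poly_Mapping.single (j # m @ m') (mat 1 $ i $ j :: 'a)) =
      (\<Sum>j\<in>UNIV. if i = j then Poly_Mapping.single (j # m @ m') 1 else 0)"
    by (rule sum.cong) (auto simp: mat_def)
  then show ?case
    using Cons by (simp add: X_times_single sigma_one delta_one)
qed simp

lemma mult_monomials:
  "mult \<sigma> \<delta> (Poly_Mapping.single m 1) (Poly_Mapping.single m' 1) = Poly_Mapping.single (m @ m') 1"
  by (simp add: mult_single word_times_single_one)

lemma mult_one_right: "mult \<sigma> \<delta> F (const 1) = F"
  by (induction F rule: skew_poly_induct)
    (simp_all add: const_def mult_add_left mult_single word_times_single_one)

lemma X_mult_const:
  "mult \<sigma> \<delta> (X i) (const c) =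
    (\<Sum>j\<in>UNIV. mult \<sigma> \<delta> (const (\<sigma> c $ i $ j)) (X j)) + const (\<delta> c $ i)"
  by (simp add: X_def const_def mult_single X_times_single)

end

end

theory Submission
  imports Defs
begin

text \<open>
  Both identities iterate a product rule for a single variable. Substituting the division
  \<open>G = \<Sum>\<^sub>i G\<^sub>i (x\<^sub>i - a\<^sub>i) + c\<close> into \<open>F G\<close> leaves \<open>\<Sum>\<^sub>i (F G\<^sub>i) (x\<^sub>i - a\<^sub>i) + F c\<close>. The last
  term \<open>F c\<close> is in general not a constant, so it has to be divided in turn; by
  uniqueness of the quotients, \<open>\<Delta>\<^sup>i (F G) = F \<Delta>\<^sup>i G + \<Delta>\<^sup>i (F G(a))\<close>. On the left side the mirror image
  is \<open>\<Delta>\<^sup>i (F G) = (\<Delta>\<^sup>i F) G + \<Delta>\<^sup>i (F(a) G)\<close>. Since the operators are additive, applying them one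
  after the other along a word produces one correction term per letter: the operators applied
  before that letter act on one factor alone, which is then evaluated; the remaining ones act on
  the product of this value with the other factor.

  The substance is that the divisions exist and are unique, which is proved by degree. The map
  \<open>(Q, c) \<mapsto> \<Sum>\<^sub>i Q\<^sub>i (x\<^sub>i - a\<^sub>i) + c\<close> is triangular with respect to the length of words: its top part
  appends the letter \<open>x\<^sub>i\<close> to the words of \<open>Q\<^sub>i\<close>, which is a bijection onto the words of positive
  length (\<open>right_division_ex1\<close>). For left division, the top part sends the coefficients
  \<open>(Q\<^sub>1(m), \<dots>, Q\<^sub>n(m))\<close> of a word \<open>m\<close> to the coefficients \<open>\<phi> (Q\<^sub>1(m), \<dots>, Q\<^sub>n(m))\<close> of the words
  \<open>x\<^sub>1 m, \<dots>, x\<^sub>n m\<close>, and this is where bijectivity of \<open>\<phi>\<close> enters (\<open>left_division_ex1\<close>). The common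
  triangularity argument is \<open>triangular_division_ex1\<close>.
\<close>

section \<open>Filtration by degree\<close>

definition deg_less :: "nat \<Rightarrow> ('a::zero, 'n) skew_poly \<Rightarrow> bool" where
  "deg_less k F \<longleftrightarrow> (\<forall>w. k \<le> length w \<longrightarrow> Poly_Mapping.lookup F w = 0)"

lemma deg_less_mono: "deg_less k F \<Longrightarrow> k \<le> l \<Longrightarrow> deg_less l F"
  by (auto simp: deg_less_def)

lemma deg_less_0_iff: "deg_less 0 F \<longleftrightarrow> F = 0"
  by (auto simp: deg_less_def intro: poly_mapping_eqI)

lemma deg_less_zero: "deg_less k 0"
  by (simp add: deg_less_def)

lemma deg_less_add: "deg_less k F \<Longrightarrow> deg_less k G \<Longrightarrow> deg_less k (F + G)"
  for F :: "('a::monoid_add, 'n) skew_poly"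
  by (simp add: deg_less_def lookup_add)

lemma deg_less_diff: "deg_less k F \<Longrightarrow> deg_less k G \<Longrightarrow> deg_less k (F - G)"
  for F :: "('a::ab_group_add, 'n) skew_poly"
  by (simp add: deg_less_def lookup_minus)

lemma deg_less_sum: "(\<And>i. i \<in> A \<Longrightarrow> deg_less k (f i)) \<Longrightarrow> deg_less k (sum f A)"
  for f :: "'b \<Rightarrow> ('a::comm_monoid_add, 'n) skew_poly"
  by (induction A rule: infinite_finite_induct) (auto simp: deg_less_zero deg_less_add)

lemma deg_less_single: "length w < k \<Longrightarrow> deg_less k (Poly_Mapping.single w c)"
  by (auto simp: deg_less_def lookup_single when_def)

lemma deg_less_scale: "deg_less k F \<Longrightarrow> deg_less k (scale c F)"
  for c :: "'a::division_ring"
  by (simp add: deg_less_def)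

lemma deg_less_const: "deg_less (Suc k) (const c)"
  by (simp add: const_def deg_less_single)

lemma deg_less_1_eq_const: "deg_less (Suc 0) F \<Longrightarrow> F = const (Poly_Mapping.lookup F [])"
  by (rule poly_mapping_eqI)
    (auto simp: deg_less_def const_def lookup_single when_def Suc_le_eq)

lemma ex_deg_less: "\<exists>k. deg_less k F"
proof -
  let ?k = "Suc (Max (length ` Poly_Mapping.keys F))"
  have "length w < ?k" if "w \<in> Poly_Mapping.keys F" for w
    using that by (simp add: less_Suc_eq_le)
  then have "deg_less ?k F"
    unfolding deg_less_def by (metis in_keys_iff leD)
  then show ?thesis ..
qed

lemma ex_common_deg_less:
  fixes Q :: "'i::finite \<Rightarrow> ('a::zero, 'n) skew_poly"
  shows "\<exists>k. \<forall>i. deg_less k (Q i)"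
proof -
  have "\<forall>i. \<exists>k. deg_less k (Q i)"
    by (simp add: ex_deg_less)
  then obtain d where d: "deg_less (d i) (Q i)" for i
    by metis
  have "deg_less (Max (range d)) (Q i)" for i
    by (rule deg_less_mono[OF d]) simp
  then show ?thesis by blast
qed

lemma const_diff: "const (c - d) = const c - const d"
  for c :: "'a::ab_group_add"
  by (simp add: const_def single_diff)

lemma const_add: "const (c + d) = const c + const d"
  for c :: "'a::comm_monoid_add"
  by (simp add: const_def single_add)

lemma const_eq_0_iff: "const c = 0 \<longleftrightarrow> c = 0"
  by (auto simp: const_def dest: arg_cong[where f = "\<lambda>F. Poly_Mapping.lookup F []"])

section \<open>Division by a triangular operator\<close>

text \<open>
  Read \<open>A Q\<close> as \<open>\<Sum>\<^sub>i Q\<^sub>i (x\<^sub>i - a\<^sub>i)\<close> or \<open>\<Sum>\<^sub>i (x\<^sub>i - a\<^sub>i) Q\<^sub>i\<close>. The hypothesis \<open>reduce\<close> says that the top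
  part of \<open>A\<close> is surjective, so that the degree of a dividend can be lowered until it is constant.
  The hypothesis \<open>cancel\<close> says that the top part is injective; it lowers the degree of a difference
  of two quotients until it vanishes.
\<close>

lemma triangular_division_ex1:
  fixes A :: "('i::finite \<Rightarrow> ('a::ab_group_add, 'n) skew_poly) \<Rightarrow> ('a, 'n) skew_poly"
  assumes diff: "\<And>Q R. A (\<lambda>i. Q i - R i) = A Q - A R"
    and reduce: "\<And>w c. w \<noteq> [] \<Longrightarrow> \<exists>Q. deg_less (length w) (Poly_Mapping.single w c - A Q)"
    and cancel: "\<And>k Q i. (\<And>j. deg_less (Suc k) (Q j)) \<Longrightarrow> deg_less (Suc k) (A Q) \<Longrightarrow> deg_less k (Q i)"
  shows "\<exists>!p. F = A (fst p) + const (snd p)"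
proof -
  have A0: "A (\<lambda>i. 0) = 0"
    using diff[of "\<lambda>i. 0" "\<lambda>i. 0"] by simp
  have A_add: "A (\<lambda>i. Q i + R i) = A Q + A R" for Q R
    using diff[of "\<lambda>i. Q i + R i" R] by simp
  have split: "\<exists>Q. deg_less k (G - A Q)" if "deg_less (Suc k) G" "k > 0" for G k
  proof -
    let ?t = "\<lambda>w. Poly_Mapping.single w (Poly_Mapping.lookup G w)"
    have "\<exists>Q. deg_less k (?t w - A Q)" for w
    proof (cases "length w < k \<or> length w > k")
      case True
      then have "deg_less k (?t w)"
        using that by (auto simp: deg_less_single deg_less_zero deg_less_def[of "Suc k"])
      then have "deg_less k (?t w - A (\<lambda>i. 0))"
        by (simp add: A0)
      then show ?thesis
        by (rule exI[of _ "\<lambda>i. 0"])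
    next
      case False
      then show ?thesis
        using reduce[of w "Poly_Mapping.lookup G w"] that by (auto simp: not_less)
    qed
    then obtain R where R: "deg_less k (?t w - A (R w))" for w
      by metis
    have A_sum: "A (\<lambda>i. \<Sum>w\<in>S. R w i) = (\<Sum>w\<in>S. A (R w))" for S
      by (induction S rule: infinite_finite_induct) (simp_all add: A0 A_add)
    have "G = (\<Sum>w\<in>Poly_Mapping.keys G. ?t w)"
      by (rule poly_mapping_eqI) (auto simp: lookup_sum lookup_single when_def in_keys_iff)
    then have "G - A (\<lambda>i. \<Sum>w\<in>Poly_Mapping.keys G. R w i) =
        (\<Sum>w\<in>Poly_Mapping.keys G. ?t w - A (R w))"
      by (simp add: A_sum sum_subtractf)
    then have "deg_less k (G - A (\<lambda>i. \<Sum>w\<in>Poly_Mapping.keys G. R w i))"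
      by (simp add: deg_less_sum R)
    then show ?thesis
      by (rule exI[of _ "\<lambda>i. \<Sum>w\<in>Poly_Mapping.keys G. R w i"])
  qed
  have ex: "\<exists>Q c. G = A Q + const c" if "deg_less (Suc k) G" for G k
    using that
  proof (induction k arbitrary: G)
    case 0
    then have "G = const (Poly_Mapping.lookup G [])"
      by (rule deg_less_1_eq_const)
    then have "G = A (\<lambda>i. 0) + const (Poly_Mapping.lookup G [])"
      by (simp only: A0 add_0)
    then show ?case by blast
  next
    case (Suc k)
    then obtain Q where "deg_less (Suc k) (G - A Q)"
      using split by blast
    then obtain R c where "G - A Q = A R + const c"
      using Suc.IH by blast
    then have "G = A (\<lambda>i. Q i + R i) + const c"
      by (simp add: A_add algebra_simps)
    then show ?case by blast
  qed
  have uniq: "Q = (\<lambda>i. 0)" if AQ: "A Q = const c" for Q c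
  proof -
    have descend: "(\<And>i. deg_less k (Q i)) \<Longrightarrow> deg_less 0 (Q i)" for k i
    proof (induction k)
      case (Suc k)
      then show ?case
        using cancel[of k Q] by (metis AQ deg_less_const)
    qed
    obtain k where "\<forall>i. deg_less k (Q i)"
      using ex_common_deg_less by blast
    then show ?thesis
      using descend by (auto simp: deg_less_0_iff)
  qed
  obtain k where "deg_less (Suc k) F"
    by (meson ex_deg_less deg_less_mono le_SucI order_refl)
  then obtain Q c where F: "F = A Q + const c"
    using ex by blast
  show ?thesis
  proof (rule ex1I[of _ "(Q, c)"])
    fix p
    assume p: "F = A (fst p) + const (snd p)"
    have eq: "A (\<lambda>i. fst p i - Q i) = const (c - snd p)"
      using F p by (simp add: diff const_diff algebra_simps)
    then have Q: "(\<lambda>i. fst p i - Q i) = (\<lambda>i. 0)"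
      by (rule uniq)
    then have "fst p = Q"
      by (auto simp: fun_eq_iff)
    moreover have "c = snd p"
      using eq Q by (simp add: A0 const_eq_0_iff flip: eq_iff_diff_eq_0)
    ultimately show "p = (Q, c)"
      by (simp add: prod_eq_iff)
  qed (simp add: F)
qed

section \<open>Existence and uniqueness of the two divisions\<close>

context
  fixes \<sigma> :: "'a::division_ring \<Rightarrow> 'a^'n^'n" and \<delta> :: "'a \<Rightarrow> 'a^'n"
  assumes hom: "matrix_ring_hom \<sigma>" and der: "vector_derivation \<sigma> \<delta>"
begin

lemma mult_diff_left: "mult \<sigma> \<delta> (F - G) H = mult \<sigma> \<delta> F H - mult \<sigma> \<delta> G H"
  using mult_add_left[OF hom der, of "F - G" G H] by simp

lemma mult_diff_right: "mult \<sigma> \<delta> F (G - H) = mult \<sigma> \<delta> F G - mult \<sigma> \<delta> F H"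
  using mult_add_right[OF hom der, of F "G - H" H] by simp

lemma mult_sum_right: "mult \<sigma> \<delta> F (sum f A) = (\<Sum>i\<in>A. mult \<sigma> \<delta> F (f i))"
  by (induction A rule: infinite_finite_induct)
    (simp_all add: mult_zero[OF hom der] mult_add_right[OF hom der])

lemma mult_X_left: "mult \<sigma> \<delta> (X i) G = X_times \<sigma> \<delta> i G"
  by (simp add: X_def mult_single[OF hom der])

lemma lookup_X_times:
  "Poly_Mapping.lookup (X_times \<sigma> \<delta> i G) w =
    (case w of [] \<Rightarrow> 0 | j # v \<Rightarrow> \<sigma> (Poly_Mapping.lookup G v) $ i $ j) +
    \<delta> (Poly_Mapping.lookup G w) $ i"
proof (induction G rule: skew_poly_induct)
  case zero
  then show ?case
    by (simp add: X_times_zero[OF hom der] sigma_zero[OF hom der] delta_zero[OF hom der] split: list.split)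
next
  case (single v c)
  have "(\<Sum>j\<in>UNIV. Poly_Mapping.lookup (Poly_Mapping.single (j # v) (\<sigma> c $ i $ j)) w) =
      (case w of [] \<Rightarrow> 0 | j # u \<Rightarrow> if v = u then \<sigma> c $ i $ j else 0)"
    by (auto simp: lookup_single when_def split: list.split)
  then show ?case
    by (auto simp: X_times_single[OF hom der] lookup_add lookup_sum lookup_single when_def
        sigma_zero[OF hom der] delta_zero[OF hom der] split: list.split)
next
  case (add F G)
  then show ?case
    by (simp add: X_times_add[OF hom der] lookup_add sigma_add[OF hom der] delta_add[OF hom der]
        split: list.split)
qed

lemma lookup_mult_X_right:
  "Poly_Mapping.lookup (mult \<sigma> \<delta> F (X i)) (w @ [j]) = (if i = j then Poly_Mapping.lookup F w else 0)"
  by (induction F rule: skew_poly_induct)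
    (auto simp: mult_zero[OF hom der] mult_add_left[OF hom der] mult_single[OF hom der] X_def
      word_times_single_one[OF hom der] lookup_add lookup_single when_def)

lemma deg_less_X_times: "deg_less k G \<Longrightarrow> deg_less (Suc k) (X_times \<sigma> \<delta> i G)"
  by (auto simp: deg_less_def lookup_X_times sigma_zero[OF hom der] delta_zero[OF hom der]
      split: list.split)

lemma deg_less_word_times: "deg_less k G \<Longrightarrow> deg_less (length w + k) (foldr (X_times \<sigma> \<delta>) w G)"
  by (induction w) (auto intro: deg_less_X_times)

lemma deg_less_mult_const:
  assumes "deg_less k F"
  shows "deg_less k (mult \<sigma> \<delta> F (const c))"
  unfolding mult_def
proof (intro deg_less_sum deg_less_scale)
  fix w assume "w \<in> Poly_Mapping.keys F"
  then have "length w + 1 \<le> k"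
    using assms by (auto simp: deg_less_def in_keys_iff not_le Suc_le_eq)
  then show "deg_less k (foldr (X_times \<sigma> \<delta>) w (const c))"
    using deg_less_word_times[OF deg_less_const[of 0]] deg_less_mono by fastforce
qed

abbreviation "right_combination a Q \<equiv> \<Sum>i\<in>UNIV. mult \<sigma> \<delta> (Q i) (X i - const (a $ i))"

abbreviation "left_combination a Q \<equiv> \<Sum>i\<in>UNIV. mult \<sigma> \<delta> (X i - const (a $ i)) (Q i)"

lemma right_division_ex1: "\<exists>!p. F = right_combination a (fst p) + const (snd p)"
proof (rule triangular_division_ex1)
  fix w :: "'n list" and c :: 'a
  assume "w \<noteq> []"
  then obtain v j where w: "w = v @ [j]"
    by (metis rev_exhaust)
  let ?Q = "\<lambda>i. if i = j then Poly_Mapping.single v c else 0"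
  have "right_combination a ?Q =
      (\<Sum>i\<in>UNIV. if i = j then mult \<sigma> \<delta> (Poly_Mapping.single v c) (X j - const (a $ j)) else 0)"
    by (rule sum.cong) (auto simp: mult_zero[OF hom der])
  also have "\<dots> = Poly_Mapping.single w c - mult \<sigma> \<delta> (Poly_Mapping.single v c) (const (a $ j))"
    by (simp add: w mult_diff_right mult_single[OF hom der] X_def word_times_single_one[OF hom der])
  finally have "Poly_Mapping.single w c - right_combination a ?Q =
      mult \<sigma> \<delta> (Poly_Mapping.single v c) (const (a $ j))"
    by simp
  moreover have "deg_less (length w) (mult \<sigma> \<delta> (Poly_Mapping.single v c) (const (a $ j)))"
    by (simp add: w deg_less_mult_const deg_less_single)
  ultimately show "\<exists>Q. deg_less (length w) (Poly_Mapping.single w c - right_combination a Q)"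
    by (intro exI[of _ ?Q]) (simp only:)
next
  fix k i and Q :: "'n \<Rightarrow> ('a, 'n) skew_poly"
  assume Q: "\<And>j. deg_less (Suc k) (Q j)" and comb: "deg_less (Suc k) (right_combination a Q)"
  show "deg_less k (Q i)"
    unfolding deg_less_def
  proof (intro allI impI)
    fix w :: "'n list"
    assume w: "k \<le> length w"
    then have "0 = Poly_Mapping.lookup (right_combination a Q) (w @ [i])"
      using comb by (simp add: deg_less_def)
    also have "\<dots> = Poly_Mapping.lookup (Q i) w"
      using w deg_less_mult_const[OF Q]
      by (simp add: mult_diff_right lookup_sum lookup_minus lookup_mult_X_right deg_less_def)
    finally show "Poly_Mapping.lookup (Q i) w = 0" by simp
  qed
qed (simp add: mult_diff_left sum_subtractf)

lemma left_division_ex1: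
  assumes bij: "bij (phi \<sigma>)"
  shows "\<exists>!p. F = left_combination a (fst p) + const (snd p)"
proof (rule triangular_division_ex1)
  fix w :: "'n list" and c :: 'a
  assume "w \<noteq> []"
  then obtain j v where w: "w = j # v"
    by (metis list.exhaust)
  \<comment> \<open>The quotients \<open>\<gamma>\<^sub>i v\<close> have \<open>\<Sum>\<^sub>i x\<^sub>i \<gamma>\<^sub>i v = \<Sum>\<^sub>l \<phi>(\<gamma>)\<^sub>l x\<^sub>l v\<close> up to multiples of \<open>v\<close>.\<close>
  obtain \<gamma> where \<gamma>: "phi \<sigma> \<gamma> = axis j c"
    using bij by (metis bij_pointE)
  let ?Q = "\<lambda>i. Poly_Mapping.single v (\<gamma> $ i)"
  have "(\<Sum>i\<in>UNIV. \<Sum>l\<in>UNIV. Poly_Mapping.single (l # v) (\<sigma> (\<gamma> $ i) $ i $ l)) =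
      (\<Sum>l\<in>UNIV. Poly_Mapping.single (l # v) (phi \<sigma> \<gamma> $ l))"
    by (subst sum.swap) (simp add: phi_def sum_single[OF hom der])
  also have "\<dots> = (\<Sum>l\<in>UNIV. if l = j then Poly_Mapping.single w c else 0)"
    by (rule sum.cong) (auto simp: \<gamma> axis_def w)
  finally have top: "(\<Sum>i\<in>UNIV. X_times \<sigma> \<delta> i (?Q i)) =
      Poly_Mapping.single w c + (\<Sum>i\<in>UNIV. Poly_Mapping.single v (\<delta> (\<gamma> $ i) $ i))"
    by (simp add: X_times_single[OF hom der] sum.distrib)
  have "Poly_Mapping.single w c - left_combination a ?Q =
      (\<Sum>i\<in>UNIV. scale (a $ i) (?Q i)) - (\<Sum>i\<in>UNIV. Poly_Mapping.single v (\<delta> (\<gamma> $ i) $ i))"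
    by (simp add: mult_diff_left mult_X_left mult_const[OF hom der] sum_subtractf top del: scale_single)
  moreover have "deg_less (length w) \<dots>"
    by (intro deg_less_diff deg_less_sum deg_less_scale deg_less_single) (simp_all add: w)
  ultimately show "\<exists>Q. deg_less (length w) (Poly_Mapping.single w c - left_combination a Q)"
    by (intro exI[of _ ?Q]) (simp only:)
next
  fix k i and Q :: "'n \<Rightarrow> ('a, 'n) skew_poly"
  assume Q: "\<And>j. deg_less (Suc k) (Q j)" and comb: "deg_less (Suc k) (left_combination a Q)"
  show "deg_less k (Q i)"
    unfolding deg_less_def
  proof (intro allI impI)
    fix w :: "'n list"
    assume w: "k \<le> length w"
    let ?\<gamma> = "\<chi> i. Poly_Mapping.lookup (Q i) w"
    have "phi \<sigma> ?\<gamma> $ j = 0" for j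
    proof -
      have "0 = Poly_Mapping.lookup (left_combination a Q) (j # w)"
        using comb w by (simp add: deg_less_def)
      also have "\<dots> = phi \<sigma> ?\<gamma> $ j"
        using Q w by (simp add: mult_diff_left mult_X_left mult_const[OF hom der] lookup_sum
            lookup_minus lookup_X_times deg_less_def delta_zero[OF hom der] phi_def)
      finally show ?thesis by simp
    qed
    moreover have "phi \<sigma> 0 $ j = 0" for j
      by (simp add: phi_def sigma_zero[OF hom der])
    ultimately have "phi \<sigma> ?\<gamma> = phi \<sigma> 0"
      by (simp add: vec_eq_iff)
    then have "?\<gamma> = 0"
      using bij by (simp add: bij_def inj_eq)
    then show "Poly_Mapping.lookup (Q i) w = 0"
      by (simp add: vec_eq_iff)
  qed
qed (simp add: mult_diff_right sum_subtractf)

text \<open>The next two lemmas turn the definite descriptions into usable characterisations.\<close>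

lemma right_division_eq_iff:
  "right_division \<sigma> \<delta> a F = p \<longleftrightarrow> F = right_combination a (fst p) + const (snd p)"
  using right_division_ex1[of F a] theI'[OF right_division_ex1[of F a]]
  by (auto simp: right_division_def case_prod_unfold)

lemma left_division_eq_iff:
  assumes "bij (phi \<sigma>)"
  shows "left_division \<sigma> \<delta> a F = p \<longleftrightarrow> F = left_combination a (fst p) + const (snd p)"
  using left_division_ex1[OF assms, of F a] theI'[OF left_division_ex1[OF assms, of F a]]
  by (auto simp: left_division_def case_prod_unfold)

lemma right_quotients_eq:
  "F = right_combination a Q + const c \<Longrightarrow> fst (right_division \<sigma> \<delta> a F) = Q"
  using right_division_eq_iff[of a F "(Q, c)"] by simp

lemma left_quotients_eq:
  "bij (phi \<sigma>) \<Longrightarrow> F = left_combination a Q + const c \<Longrightarrow> fst (left_division \<sigma> \<delta> a F) = Q"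
  using left_division_eq_iff[of a F "(Q, c)"] by simp

section \<open>The product rules\<close>

lemma Delta_Cons: "Delta \<sigma> \<delta> a (i # m) F = Delta \<sigma> \<delta> a [i] (Delta \<sigma> \<delta> a m F)"
  by (simp add: Delta_def)

lemma Delta_left_snoc:
  "Delta_left \<sigma> \<delta> a (m @ [i]) F = Delta_left \<sigma> \<delta> a [i] (Delta_left \<sigma> \<delta> a m F)"
  by (simp add: Delta_left_def)

lemma right_division_expansion:
  "F = right_combination a (\<lambda>i. Delta \<sigma> \<delta> a [i] F) + const (eval_right \<sigma> \<delta> a F)"
  using right_division_eq_iff[of a F "right_division \<sigma> \<delta> a F"]
  by (simp add: Delta_def eval_right_def)

lemma left_division_expansion:
  assumes "bij (phi \<sigma>)"
  shows "F = left_combination a (\<lambda>i. Delta_left \<sigma> \<delta> a [i] F) + const (eval_left \<sigma> \<delta> a F)"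
  using left_division_eq_iff[OF assms, of a F "left_division \<sigma> \<delta> a F"]
  by (simp add: Delta_left_def eval_left_def)

lemma Delta_single_eqI:
  "F = right_combination a Q + const c \<Longrightarrow> Delta \<sigma> \<delta> a [i] F = Q i"
  using right_quotients_eq by (simp add: Delta_def)

lemma Delta_left_single_eqI:
  "bij (phi \<sigma>) \<Longrightarrow> F = left_combination a Q + const c \<Longrightarrow> Delta_left \<sigma> \<delta> a [i] F = Q i"
  using left_quotients_eq by (simp add: Delta_left_def)

lemma Delta_single_add:
  "Delta \<sigma> \<delta> a [i] (F + G) = Delta \<sigma> \<delta> a [i] F + Delta \<sigma> \<delta> a [i] G"
proof (rule Delta_single_eqI)
  show "F + G = right_combination a (\<lambda>i. Delta \<sigma> \<delta> a [i] F + Delta \<sigma> \<delta> a [i] G) +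
      const (eval_right \<sigma> \<delta> a F + eval_right \<sigma> \<delta> a G)"
    by (subst (1) right_division_expansion[of F a], subst (1) right_division_expansion[of G a])
      (simp add: mult_add_left[OF hom der] sum.distrib const_add)
qed

lemma Delta_left_single_add:
  assumes bij: "bij (phi \<sigma>)"
  shows "Delta_left \<sigma> \<delta> a [i] (F + G) = Delta_left \<sigma> \<delta> a [i] F + Delta_left \<sigma> \<delta> a [i] G"
proof (rule Delta_left_single_eqI[OF bij])
  show "F + G = left_combination a (\<lambda>i. Delta_left \<sigma> \<delta> a [i] F + Delta_left \<sigma> \<delta> a [i] G) +
      const (eval_left \<sigma> \<delta> a F + eval_left \<sigma> \<delta> a G)"
    by (subst (1) left_division_expansion[OF bij, of F a],
        subst (1) left_division_expansion[OF bij, of G a])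
      (simp add: mult_add_right[OF hom der] sum.distrib const_add)
qed

lemma Delta_single_sum:
  "Delta \<sigma> \<delta> a [i] (sum f S) = (\<Sum>k\<in>S. Delta \<sigma> \<delta> a [i] (f k))"
proof -
  have "Delta \<sigma> \<delta> a [i] 0 = 0"
    using Delta_single_add[of a i 0 0] by simp
  then show ?thesis
    by (induction S rule: infinite_finite_induct) (simp_all add: Delta_single_add)
qed

lemma Delta_left_single_sum:
  assumes bij: "bij (phi \<sigma>)"
  shows "Delta_left \<sigma> \<delta> a [i] (sum f S) = (\<Sum>k\<in>S. Delta_left \<sigma> \<delta> a [i] (f k))"
proof -
  have "Delta_left \<sigma> \<delta> a [i] 0 = 0"
    using Delta_left_single_add[OF bij, of a i 0 0] by simp
  then show ?thesis
    by (induction S rule: infinite_finite_induct) (simp_all add: Delta_left_single_add[OF bij])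
qed

text \<open>Multiply the division of \<open>G\<close> by \<open>F\<close> and divide the one remaining term \<open>F G(a)\<close>.\<close>

lemma Delta_single_mult:
  "Delta \<sigma> \<delta> a [i] (mult \<sigma> \<delta> F G) =
    mult \<sigma> \<delta> F (Delta \<sigma> \<delta> a [i] G) +
    Delta \<sigma> \<delta> a [i] (mult \<sigma> \<delta> F (const (eval_right \<sigma> \<delta> a G)))"
proof (rule Delta_single_eqI)
  let ?H = "mult \<sigma> \<delta> F (const (eval_right \<sigma> \<delta> a G))"
  have "mult \<sigma> \<delta> F G =
      mult \<sigma> \<delta> F (right_combination a (\<lambda>i. Delta \<sigma> \<delta> a [i] G) + const (eval_right \<sigma> \<delta> a G))"
    by (rule arg_cong[OF right_division_expansion])
  also have "\<dots> = right_combination a (\<lambda>i. mult \<sigma> \<delta> F (Delta \<sigma> \<delta> a [i] G)) + ?H"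
    by (simp add: mult_add_right[OF hom der] mult_sum_right mult_assoc[OF hom der])
  also have "?H = right_combination a (\<lambda>i. Delta \<sigma> \<delta> a [i] ?H) + const (eval_right \<sigma> \<delta> a ?H)"
    by (rule right_division_expansion)
  finally show "mult \<sigma> \<delta> F G =
      right_combination a (\<lambda>i. mult \<sigma> \<delta> F (Delta \<sigma> \<delta> a [i] G) + Delta \<sigma> \<delta> a [i] ?H) +
      const (eval_right \<sigma> \<delta> a ?H)"
    by (simp add: mult_add_left[OF hom der] sum.distrib add.assoc)
qed

text \<open>The mirror image: multiply the division of \<open>F\<close> by \<open>G\<close> and divide \<open>F(a) G\<close>.\<close>

lemma Delta_left_single_mult:
  assumes bij: "bij (phi \<sigma>)"
  shows "Delta_left \<sigma> \<delta> a [i] (mult \<sigma> \<delta> F G) =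
    mult \<sigma> \<delta> (Delta_left \<sigma> \<delta> a [i] F) G +
    Delta_left \<sigma> \<delta> a [i] (mult \<sigma> \<delta> (const (eval_left \<sigma> \<delta> a F)) G)"
proof (rule Delta_left_single_eqI[OF bij])
  let ?H = "mult \<sigma> \<delta> (const (eval_left \<sigma> \<delta> a F)) G"
  have "mult \<sigma> \<delta> F G =
      mult \<sigma> \<delta> (left_combination a (\<lambda>i. Delta_left \<sigma> \<delta> a [i] F) + const (eval_left \<sigma> \<delta> a F)) G"
    by (rule arg_cong[where f = "\<lambda>H. mult \<sigma> \<delta> H G", OF left_division_expansion[OF bij]])
  also have "\<dots> = left_combination a (\<lambda>i. mult \<sigma> \<delta> (Delta_left \<sigma> \<delta> a [i] F) G) + ?H"
    by (simp add: mult_add_left[OF hom der] mult_sum_left[OF hom der] mult_assoc[OF hom der])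
  also have "?H = left_combination a (\<lambda>i. Delta_left \<sigma> \<delta> a [i] ?H) + const (eval_left \<sigma> \<delta> a ?H)"
    by (rule left_division_expansion[OF bij])
  finally show "mult \<sigma> \<delta> F G =
      left_combination a (\<lambda>i. mult \<sigma> \<delta> (Delta_left \<sigma> \<delta> a [i] F) G + Delta_left \<sigma> \<delta> a [i] ?H) +
      const (eval_left \<sigma> \<delta> a ?H)"
    by (simp add: mult_add_right[OF hom der] sum.distrib add.assoc)
qed

text \<open>
  The operator of the first letter acts last, so the word grows at the front. The rule for that
  letter, applied to the leading term \<open>F \<Delta>\<^sup>m G\<close>, gives the new summand \<open>k = 1\<close>; by additivity every
  old summand has its outer prefix extended and becomes the summand with index \<open>k + 1\<close>.
\<close>

lemma Delta_mult:
  "Delta \<sigma> \<delta> a m (mult \<sigma> \<delta> F G) =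
    mult \<sigma> \<delta> F (Delta \<sigma> \<delta> a m G) +
    (\<Sum>k=1..length m. Delta \<sigma> \<delta> a (take k m)
      (mult \<sigma> \<delta> F (const (eval_right \<sigma> \<delta> a (Delta \<sigma> \<delta> a (drop k m) G)))))"
proof (induction m)
  case Nil
  then show ?case by (simp add: Delta_def)
next
  case (Cons i m)
  define T where "T w k = Delta \<sigma> \<delta> a (take k w)
      (mult \<sigma> \<delta> F (const (eval_right \<sigma> \<delta> a (Delta \<sigma> \<delta> a (drop k w) G))))" for w k
  have step: "T (i # m) (Suc k) = Delta \<sigma> \<delta> a [i] (T m k)" for k
    by (simp add: T_def Delta_Cons[of a i "take k m"])
  have T0: "T m 0 = mult \<sigma> \<delta> F (const (eval_right \<sigma> \<delta> a (Delta \<sigma> \<delta> a m G)))"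
    by (simp add: T_def Delta_def)
  have "Delta \<sigma> \<delta> a (i # m) (mult \<sigma> \<delta> F G) =
      Delta \<sigma> \<delta> a [i] (mult \<sigma> \<delta> F (Delta \<sigma> \<delta> a m G) + (\<Sum>k=1..length m. T m k))"
    using Cons.IH by (simp add: Delta_Cons[of a i m] T_def)
  also have "\<dots> = mult \<sigma> \<delta> F (Delta \<sigma> \<delta> a (i # m) G) +
      (T (i # m) (Suc 0) + (\<Sum>k=1..length m. T (i # m) (Suc k)))"
    by (simp add: Delta_single_add Delta_single_sum step T0 Delta_Cons[of a i m] add.assoc
        Delta_single_mult[of a i F "Delta \<sigma> \<delta> a m G"])
  also have "T (i # m) (Suc 0) + (\<Sum>k=1..length m. T (i # m) (Suc k)) =
      (\<Sum>k=0..length m. T (i # m) (Suc k))"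
    by (simp add: sum.atLeast_Suc_atMost)
  also have "\<dots> = (\<Sum>k=1..length (i # m). T (i # m) k)"
    using sum.shift_bounds_cl_Suc_ivl[of "T (i # m)" 0 "length m"] by simp
  finally show ?case by (simp only: T_def)
qed

text \<open>Here the operator of the last letter acts last, so the word grows at the end.\<close>

lemma Delta_left_mult:
  assumes bij: "bij (phi \<sigma>)"
  shows "Delta_left \<sigma> \<delta> a m (mult \<sigma> \<delta> F G) =
    mult \<sigma> \<delta> (Delta_left \<sigma> \<delta> a m F) G +
    (\<Sum>k=1..length m. Delta_left \<sigma> \<delta> a (drop (length m - k) m)
      (mult \<sigma> \<delta> (const (eval_left \<sigma> \<delta> a (Delta_left \<sigma> \<delta> a (take (length m - k) m) F))) G))"
proof (induction m rule: rev_induct)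
  case Nil
  then show ?case by (simp add: Delta_left_def)
next
  case (snoc i m)
  define T where "T w k = Delta_left \<sigma> \<delta> a (drop (length w - k) w)
      (mult \<sigma> \<delta> (const (eval_left \<sigma> \<delta> a (Delta_left \<sigma> \<delta> a (take (length w - k) w) F))) G)" for w k
  have step: "T (m @ [i]) (Suc k) = Delta_left \<sigma> \<delta> a [i] (T m k)" for k
    by (simp add: T_def Delta_left_snoc)
  have T0: "T m 0 = mult \<sigma> \<delta> (const (eval_left \<sigma> \<delta> a (Delta_left \<sigma> \<delta> a m F))) G"
    by (simp add: T_def Delta_left_def)
  have "Delta_left \<sigma> \<delta> a (m @ [i]) (mult \<sigma> \<delta> F G) =
      Delta_left \<sigma> \<delta> a [i] (mult \<sigma> \<delta> (Delta_left \<sigma> \<delta> a m F) G + (\<Sum>k=1..length m. T m k))"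
    using snoc.IH by (simp add: Delta_left_snoc T_def)
  also have "\<dots> = mult \<sigma> \<delta> (Delta_left \<sigma> \<delta> a (m @ [i]) F) G +
      (T (m @ [i]) (Suc 0) + (\<Sum>k=1..length m. T (m @ [i]) (Suc k)))"
    by (simp add: Delta_left_single_add[OF bij] Delta_left_single_sum[OF bij]
        Delta_left_single_mult[OF bij, of a i "Delta_left \<sigma> \<delta> a m F"] step T0
        Delta_left_snoc add.assoc)
  also have "T (m @ [i]) (Suc 0) + (\<Sum>k=1..length m. T (m @ [i]) (Suc k)) =
      (\<Sum>k=0..length m. T (m @ [i]) (Suc k))"
    by (simp add: sum.atLeast_Suc_atMost)
  also have "\<dots> = (\<Sum>k=1..length (m @ [i]). T (m @ [i]) k)"
    using sum.shift_bounds_cl_Suc_ivl[of "T (m @ [i])" 0 "length m"] by simp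
  finally show ?case by (simp only: T_def)
qed

end

theorem lemma2p6:
  fixes \<sigma> :: "'a::division_ring \<Rightarrow> 'a^'n^'n" and \<delta> :: "'a \<Rightarrow> 'a^'n"
    and F G :: "('a, 'n) skew_poly" and a :: "'a^'n" and m :: "'n list"
  assumes "matrix_ring_hom \<sigma>" and "vector_derivation \<sigma> \<delta>"
  shows "Delta \<sigma> \<delta> a m (mult \<sigma> \<delta> F G) =
      mult \<sigma> \<delta> F (Delta \<sigma> \<delta> a m G) +
      (\<Sum>k=1..length m. Delta \<sigma> \<delta> a (take k m)
        (mult \<sigma> \<delta> F (const (eval_right \<sigma> \<delta> a (Delta \<sigma> \<delta> a (drop k m) G))))) \<and>
    (Modules.additive (phi \<sigma>) \<and> bij (phi \<sigma>) \<longrightarrow>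
      Delta_left \<sigma> \<delta> a m (mult \<sigma> \<delta> F G) =
      mult \<sigma> \<delta> (Delta_left \<sigma> \<delta> a m F) G +
      (\<Sum>k=1..length m. Delta_left \<sigma> \<delta> a (drop (length m - k) m)
        (mult \<sigma> \<delta> (const (eval_left \<sigma> \<delta> a (Delta_left \<sigma> \<delta> a (take (length m - k) m) F))) G)))"
  using Delta_mult[OF assms] Delta_left_mult[OF assms] by blast

end
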